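(* Let $C\in\mathbb{R}^{m\times m}$ be an invertible matrix whose columns generate the simplicial cone $C\mathbb{R}_+^m$, and let $L=C^{-1}$. Then for every finite set $A\subset\mathbb{R}^m$ and every $r\in\mathbb{R}^m$, $$\mathrm{CHV}_{C,r}(A)=|\det C|\,\mathrm{HV}_{Lr}(LA).$$ Consequently, cone-based EHVI is ordinary EHVI in cone coordinates up to the positive factor $|\det C|$: for every random vector $Y$ in $\mathbb{R}^m$, $$\mathbb{E}\bigl[\mathrm{CHV}_{C,r}(A\cup\{Y\})-\mathrm{CHV}_{C,r}(A)\bigr]=|\det C|\;\mathbb{E}\bigl[\mathrm{HV}_{Lr}(LA\cup\{LY\})-\mathrm{HV}_{Lr}(LA)\bigr],$$ where both expectations are taken in $[0,\infty]$.
   Context: Minimization convention. For finite $A\subset\mathbb{R}^m$, $r\in\mathbb{R}^m$: $\mathrm{HV}_r(A)$ is the Lebesgue measure of $\bigcup_{a\in A}[a_1,r_1]\times\cdots\times[a_m,r_m]$ (a box being empty if $a_j>r_j$ for some $j$). The simplicial cone, also denoted $C$, is $C\mathbb{R}_+^m=\{Cu:u\in\mathbb{R}_+^m\}$ with $\mathbb{R}_+=[0,\infty)$. A point $y'$ is dominated by $y$ in the cone order iff $y'-y\in C\mathbb{R}_+^m$. The cone-based hypervolume $\mathrm{CHV}_{C,r}(A)$ is the Lebesgue measure of the cone-dominated region bounded by $r$, $\bigcup_{a\in A}\{z\in\mathbb{R}^m: z-a\in C\mathbb{R}_+^m,\ r-z\in C\mathbb{R}_+^m\}$. $LA=\{La:a\in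 A\}$. *)

theory Defs
  imports "HOL-Probability.Probability"
begin

definition simplicial_cone :: "real ^ 'm ^ 'm \<Rightarrow> (real ^ 'm) set" where
  "simplicial_cone C = {C *v u | u. \<forall>i. 0 \<le> u $ i}"

text \<open>
  \<open>cbox a r\<close> is the product of the closed intervals from \<open>a $ i\<close> to \<open>r $ i\<close>; it is empty as soon
  as \<open>r $ j < a $ j\<close> for some \<open>j\<close>.
\<close>

definition HV :: "real ^ 'm \<Rightarrow> (real ^ 'm) set \<Rightarrow> ennreal" where
  "HV r A = emeasure lebesgue (\<Union>a\<in>A. cbox a r)"

definition CHV :: "real ^ 'm ^ 'm \<Rightarrow> real ^ 'm \<Rightarrow> (real ^ 'm) set \<Rightarrow> ennreal" where
  "CHV C r A = emeasure lebesgue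
     (\<Union>a\<in>A. {z. z - a \<in> simplicial_cone C \<and> r - z \<in> simplicial_cone C})"

text \<open>
  Subtraction on \<^typ>\<open>ennreal\<close> is truncated. For the improvements \<open>HV r (A \<union> {y}) - HV r A\<close> and
  \<open>CHV C r (A \<union> {y}) - CHV C r A\<close> it is the ordinary difference, since (for finite \<open>A\<close> and
  invertible \<open>C\<close>) the values are finite and the first one is at least the second, as shown below.
\<close>

lemma emeasure_lebesgue_bounded_finite:
  fixes S :: "(real ^ 'm) set"
  assumes "bounded S"
  shows "emeasure lebesgue S < \<infinity>"
proof -
  obtain a b where "S \<subseteq> cbox a b"
    using assms bounded_subset_cbox_symmetric by blast
  then have "emeasure lebesgue S \<le> emeasure lebesgue (cbox a b)"
    by (intro emeasure_mono) auto
  also have "\<dots> < \<infinity>"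
    by (simp add: emeasure_lborel_cbox_eq)
  finally show ?thesis .
qed

lemma HV_finite: "finite A \<Longrightarrow> HV r A < \<infinity>"
  unfolding HV_def by (intro emeasure_lebesgue_bounded_finite bounded_UN) auto

lemma HV_mono:
  assumes "finite B" "A \<subseteq> B"
  shows "HV r A \<le> HV r B"
  unfolding HV_def using assms
  by (intro emeasure_mono) (auto intro!: sets.finite_UN)

lemma cone_region_eq:
  fixes C :: "real ^ 'm ^ 'm"
  assumes "invertible C"
  shows "{z. z - a \<in> simplicial_cone C \<and> r - z \<in> simplicial_cone C}
           = (\<lambda>u. a + C *v u) ` cbox 0 (matrix_inv C *v (r - a))"
    (is "?l = ?r")
proof (intro set_eqI iffI)
  let ?L = "matrix_inv C"
  have inv: "C ** ?L = mat 1 \<and> ?L ** C = mat 1"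
    using assms unfolding invertible_def matrix_inv_def by (rule someI_ex)
  have LC: "?L *v (C *v u) = u" and CL: "C *v (?L *v u) = u" for u
    using inv by (simp_all add: matrix_vector_mul_assoc)
  fix z
  {
    assume "z \<in> ?l"
    then obtain u v where u: "z - a = C *v u" "\<forall>i. 0 \<le> u $ i"
      and v: "r - z = C *v v" "\<forall>i. 0 \<le> v $ i"
      by (auto simp: simplicial_cone_def)
    have "r - a = C *v (u + v)"
      using u(1) v(1) by (simp add: matrix_vector_right_distrib algebra_simps)
    then have "?L *v (r - a) = u + v"
      by (simp add: LC)
    then have "u \<in> cbox 0 (?L *v (r - a))"
      using u v by (simp add: mem_box_cart)
    moreover have "z = a + C *v u"
      using u(1) by (simp add: algebra_simps)
    ultimately show "z \<in> ?r" by blast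
  next
    assume "z \<in> ?r"
    then obtain u where u: "z = a + C *v u" "u \<in> cbox 0 (?L *v (r - a))" by auto
    have "r - z = C *v (?L *v (r - a) - u)"
      by (simp add: u(1) matrix_vector_mult_diff_distrib CL)
    moreover have "\<forall>i. 0 \<le> (?L *v (r - a) - u) $ i" "\<forall>i. 0 \<le> u $ i"
      using u(2) by (simp_all add: mem_box_cart)
    moreover have "z - a = C *v u" using u(1) by simp
    ultimately show "z \<in> ?l"
      unfolding simplicial_cone_def by blast
  }
qed

lemma compact_cone_region:
  fixes C :: "real ^ 'm ^ 'm"
  assumes "invertible C"
  shows "compact {z. z - a \<in> simplicial_cone C \<and> r - z \<in> simplicial_cone C}"
  unfolding cone_region_eq[OF assms]
  by (intro compact_continuous_image compact_cbox continuous_intros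
        linear_continuous_on matrix_vector_mul_bounded_linear)

lemma CHV_finite:
  assumes "invertible C" "finite A"
  shows "CHV C r A < \<infinity>"
  unfolding CHV_def using assms
  by (intro emeasure_lebesgue_bounded_finite bounded_UN ballI compact_imp_bounded
        compact_cone_region)

lemma CHV_mono:
  assumes "invertible C" "finite B" "A \<subseteq> B"
  shows "CHV C r A \<le> CHV C r B"
proof -
  have "(\<Union>a\<in>B. {z. z - a \<in> simplicial_cone C \<and> r - z \<in> simplicial_cone C}) \<in> sets lebesgue"
    using assms(2) by (intro sets.finite_UN lmeasurable_compact[THEN fmeasurableD] compact_cone_region assms(1))
  then show ?thesis
    unfolding CHV_def using assms(3) by (intro emeasure_mono) auto
qed

end

theory Submission
  imports Defs
begin

text \<open>
  Multiplication by \<open>C\<close> carries the componentwise order to the cone order, so the cone box between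
  \<open>a\<close> and \<open>r\<close> is the image under \<open>C\<close> of the ordinary box between \<open>L *v a\<close> and \<open>L *v r\<close>
  (\<open>cone_box_eq_image_cbox\<close>). Images commute with unions, so the whole dominated region is the image
  of the ordinary one, and a linear map multiplies Lebesgue measure by the absolute value of its
  determinant (\<open>emeasure_matrix_image\<close>). This gives the identity for \<open>CHV\<close>.

  For the expectations, apply this identity to both terms of the improvement at every outcome: the
  finite constant \<open>\<bar>det C\<bar>\<close> factors out of the truncated difference. Taking it out of the integral
  as well uses that the improvement is a measurable function of the outcome
  (\<open>borel_measurable_HV_insert\<close>): the dominated region of \<open>B \<union> {y}\<close> is the section at \<open>y\<close> of a closed
  set in the product space, and measures of sections of a Borel set depend measurably on the
  base point.
\<close>

section \<open>Linear maps scale Lebesgue measure by the determinant\<close>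

text \<open>
  A shear matrix arises from the identity matrix by adding one row to another.
\<close>

lemma det_matrix_shear:
  fixes m n :: "'n::finite"
  assumes "m \<noteq> n"
  shows "det (matrix (\<lambda>x::real^'n. \<chi> i. if i = m then x$m + x$n else x$i)) = 1"
proof -
  have "matrix (\<lambda>x::real^'n. \<chi> i. if i = m then x$m + x$n else x$i)
          = (\<chi> k. if k = m then row m (mat 1) + 1 *s row n (mat 1) else row k (mat 1))"
    by (auto simp: vec_eq_iff matrix_def row_def mat_def axis_def)
  then show ?thesis
    by (simp add: det_row_operation[OF assms])
qed

lemma abs_det_matrix_involution:
  fixes f :: "real^'n \<Rightarrow> real^'n"
  assumes "linear f" and "f \<circ> f = id"
  shows "\<bar>det (matrix f)\<bar> = 1"
proof -
  have "det (matrix f) * det (matrix f) = det (matrix (f \<circ> f))"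
    by (simp add: matrix_compose[OF assms(1,1)] det_mul)
  also have "\<dots> = 1"
    unfolding assms(2) by (simp add: matrix_id_mat_1)
  finally show ?thesis
    by (metis abs_square_eq_1 power2_eq_square)
qed

text \<open>
  The inclusion from left to right, applied to the swapped corners, gives the converse, because
  the swap is its own inverse.
\<close>

lemma image_swap_cbox:
  fixes m n :: "'n::finite" and a b :: "real^'n"
  defines "h \<equiv> \<lambda>x::real^'n. \<chi> i. x $ Transposition.transpose m n i"
  shows "h ` cbox a b = cbox (h a) (h b)"
proof -
  have hh: "h (h x) = x" for x
    by (simp add: h_def)
  have sub: "h ` cbox u v \<subseteq> cbox (h u) (h v)" for u v
    by (auto simp: h_def mem_box_cart)
  have "cbox (h a) (h b) \<subseteq> h ` cbox a b"
    using image_mono[OF sub[of "h a" "h b"], of h] by (simp add: hh image_image)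
  with sub show ?thesis by blast
qed

lemma measure_swap_cbox:
  fixes a b :: "real^'n"
  shows "measure lebesgue ((\<lambda>x::real^'n. \<chi> i. x $ Transposition.transpose m n i) ` cbox a b)
           = measure lebesgue (cbox a b)"
proof -
  let ?h = "\<lambda>x::real^'n. \<chi> i. x $ Transposition.transpose m n i"
  have ne: "cbox (?h a) (?h b) = {} \<longleftrightarrow> cbox a b = {}"
    by (metis image_is_empty image_swap_cbox)
  have "(\<Prod>i\<in>UNIV. b $ Transposition.transpose m n i - a $ Transposition.transpose m n i)
          = (\<Prod>i\<in>UNIV. b $ i - a $ i)"
    by (rule prod.reindex_bij_betw[where g = "\<lambda>i. b $ i - a $ i"]) simp
  then show ?thesis
    unfolding image_swap_cbox using ne by (simp add: content_cbox_if_cart)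
qed

text \<open>
  The scaling factor and the determinant are both multiplicative under composition, so it suffices to
  treat the maps that generate all linear maps: maps into a coordinate hyperplane, which have determinant zero and negligible
  images, together with diagonal maps, coordinate swaps and shears. For swaps and shears, it is
  enough that they preserve the measure of boxes.
\<close>

lemma lmeasurable_linear_image_det:
  fixes f :: "real^'n \<Rightarrow> real^'n"
  assumes "linear f" and "S \<in> lmeasurable"
  shows "f ` S \<in> lmeasurable \<and> measure lebesgue (f ` S) = \<bar>det (matrix f)\<bar> * measure lebesgue S"
proof -
  define scales :: "(real^'n \<Rightarrow> real^'n) \<Rightarrow> bool" where
    "scales g \<longleftrightarrow> (\<forall>S \<in> lmeasurable. g ` S \<in> lmeasurable
        \<and> measure lebesgue (g ` S) = \<bar>det (matrix g)\<bar> * measure lebesgue S)" for g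
  have volume_preserving: "scales g"
    if "linear g" and "\<bar>det (matrix g)\<bar> = 1"
      and "\<And>a b. measure lebesgue (g ` cbox a b) = measure lebesgue (cbox a b)" for g
    unfolding scales_def
  proof
    fix T :: "(real^'n) set"
    assume "T \<in> lmeasurable"
    then have "g ` T \<in> lmeasurable \<and> 1 * measure lebesgue T = measure lebesgue (g ` T)"
      using that(1,3) by (intro measure_linear_sufficient) simp_all
    then show "g ` T \<in> lmeasurable
        \<and> measure lebesgue (g ` T) = \<bar>det (matrix g)\<bar> * measure lebesgue T"
      unfolding that(2) by metis
  qed
  have "scales f"
    using \<open>linear f\<close>
  proof (rule induct_linear_elementary)
    fix g h :: "real^'n \<Rightarrow> real^'n"
    assume lin: "linear g" "linear h" and scales: "scales g" "scales h"
    have comp: "(g \<circ> h) ` S = g ` (h ` S)" for S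
      by (simp only: image_comp)
    have det: "\<bar>det (matrix (g \<circ> h))\<bar> = \<bar>det (matrix g)\<bar> * \<bar>det (matrix h)\<bar>"
      by (simp only: matrix_compose[OF lin(2,1)] det_mul abs_mult)
    show "scales (g \<circ> h)"
      using scales unfolding scales_def comp det by (simp only: mult.assoc simp_thms) simp
  next
    fix g :: "real^'n \<Rightarrow> real^'n" and i
    assume g: "linear g" and z: "\<And>x. g x $ i = 0"
    have "axis i 1 \<notin> range g"
      using z by (metis axis_nth rangeE zero_neq_one)
    then have "\<not> inj g"
      using linear_injective_imp_surjective[OF g] by auto
    then have "det (matrix g) = 0"
      using det_nz_iff_inj[OF g] by blast
    moreover have "negligible (g ` S)" for S
      by (rule negligible_subset[OF negligible_standard_hyperplane_cart[where k = i]]) (auto simp: z)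
    ultimately show "scales g"
      unfolding scales_def by (simp add: negligible_iff_measure)
  next
    fix c :: "'n \<Rightarrow> real"
    have "det (matrix (\<lambda>x::real^'n. \<chi> i. c i * x $ i)) = prod c UNIV"
      by (subst det_diagonal) (auto simp: matrix_def axis_def)
    then show "scales (\<lambda>x. \<chi> i. c i * x $ i)"
      unfolding scales_def by (simp add: measurable_stretch measure_stretch)
  next
    fix m n :: 'n
    let ?h = "\<lambda>x::real^'n. \<chi> i. x $ Transposition.transpose m n i"
    have lin: "linear ?h"
      by (rule linearI) (simp_all add: vec_eq_iff)
    have "\<bar>det (matrix ?h)\<bar> = 1"
      by (rule abs_det_matrix_involution[OF lin]) (simp add: fun_eq_iff vec_eq_iff)
    with lin show "scales ?h"
      by (rule volume_preserving) (rule measure_swap_cbox)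
  next
    fix m n :: 'n
    assume mn: "m \<noteq> n"
    let ?h = "\<lambda>x::real^'n. \<chi> i. if i = m then x$m + x$n else x$i"
    have lin: "linear ?h"
      by (rule linearI) (auto simp: vec_eq_iff distrib_left)
    have box: "measure lebesgue (?h ` cbox a b) = measure lebesgue (cbox a b)" for a b
    proof (cases "cbox a b = {}")
      case False
      \<comment> \<open>\<open>measure_shear_interval\<close> needs a box whose lower corner is nonnegative in coordinate \<open>n\<close>;
        translating by \<open>v\<close> moves that coordinate of the corner to 0.\<close>
      define v :: "real^'n" where "v = (\<chi> i. if i = n then - a$n else 0)"
      have box_v: "(+) v ` cbox a b = cbox (v + a) (v + b)"
        by (simp add: cbox_translation)
      have ne: "cbox (v + a) (v + b) \<noteq> {}"
        using False unfolding box_v[symmetric] by simp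
      have nonneg: "0 \<le> (v + a) $ n"
        by (simp add: v_def)
      have "measure lebesgue (?h ` cbox a b) = measure lebesgue ((+) (?h v) ` ?h ` cbox a b)"
        by (rule measure_translation[symmetric])
      also have "(+) (?h v) ` ?h ` cbox a b = ?h ` (+) v ` cbox a b"
        unfolding image_image linear_add[OF lin] ..
      also have "measure lebesgue (?h ` (+) v ` cbox a b) = measure lebesgue ((+) v ` cbox a b)"
        unfolding box_v by (rule measure_shear_interval[OF mn ne nonneg])
      also have "\<dots> = measure lebesgue (cbox a b)"
        by (rule measure_translation)
      finally show ?thesis .
    qed simp
    show "scales ?h"
      using lin
    proof (rule volume_preserving)
      show "\<bar>det (matrix ?h)\<bar> = 1"
        by (simp only: det_matrix_shear[OF mn] abs_one)
    qed (rule box)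
  qed
  with \<open>S \<in> lmeasurable\<close> show ?thesis
    by (simp add: scales_def)
qed

lemma emeasure_matrix_image:
  fixes C :: "real^'n^'n"
  assumes "S \<in> lmeasurable"
  shows "emeasure lebesgue ((*v) C ` S) = ennreal \<bar>det C\<bar> * emeasure lebesgue S"
  using lmeasurable_linear_image_det[OF matrix_vector_mul_linear assms, of C] assms
  by (simp add: emeasure_eq_measure2 fmeasurableD2 ennreal_mult)

section \<open>Cone coordinates\<close>

lemma matrix_inv_cancel:
  fixes C :: "real^'n^'n"
  assumes "invertible C"
  shows "C *v (matrix_inv C *v x) = x"
proof -
  have "C ** matrix_inv C = mat 1 \<and> matrix_inv C ** C = mat 1"
    using assms unfolding invertible_def matrix_inv_def by (rule someI_ex)
  then show ?thesis
    by (simp add: matrix_vector_mul_assoc)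
qed

text \<open>
  By \<open>cone_region_eq\<close> the region is an affine image of the box from \<open>0\<close> to \<open>L *v (r - a)\<close>, where
  \<open>L\<close> is the inverse of \<open>C\<close>. Since \<open>a = C *v (L *v a)\<close>, the translation by \<open>a\<close> can be moved inside
  \<open>C\<close>; then the linear map is the same for all \<open>a\<close>, so unions over \<open>a\<close> commute with it.
\<close>

lemma cone_box_eq_image_cbox:
  fixes C :: "real^'n^'n"
  assumes "invertible C"
  shows "{z. z - a \<in> simplicial_cone C \<and> r - z \<in> simplicial_cone C}
           = (*v) C ` cbox (matrix_inv C *v a) (matrix_inv C *v r)"
proof -
  let ?L = "matrix_inv C"
  have "{z. z - a \<in> simplicial_cone C \<and> r - z \<in> simplicial_cone C}
          = (\<lambda>u. C *v (?L *v a + u)) ` cbox 0 (?L *v (r - a))"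
    by (simp add: cone_region_eq[OF assms] matrix_vector_right_distrib matrix_inv_cancel[OF assms])
  also have "\<dots> = (*v) C ` (+) (?L *v a) ` cbox 0 (?L *v (r - a))"
    by (simp add: image_image)
  also have "(+) (?L *v a) ` cbox 0 (?L *v (r - a)) = cbox (?L *v a) (?L *v r)"
    by (simp add: cbox_translation[symmetric] matrix_vector_mult_diff_distrib)
  finally show ?thesis .
qed

lemma CHV_eq_det_mult_HV:
  fixes C :: "real^'n^'n"
  assumes "invertible C" and "finite A"
  shows "CHV C r A = ennreal \<bar>det C\<bar> * HV (matrix_inv C *v r) ((\<lambda>a. matrix_inv C *v a) ` A)"
proof -
  let ?U = "\<Union>a\<in>A. cbox (matrix_inv C *v a) (matrix_inv C *v r)"
  have "?U \<in> lmeasurable"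
    using assms(2) by (intro fmeasurable.finite_UN) auto
  moreover have "(\<Union>a\<in>A. {z. z - a \<in> simplicial_cone C \<and> r - z \<in> simplicial_cone C}) = (*v) C ` ?U"
    unfolding cone_box_eq_image_cbox[OF assms(1)] by (simp add: image_UN)
  ultimately show ?thesis
    unfolding CHV_def HV_def by (simp add: emeasure_matrix_image)
qed

section \<open>Expected improvement\<close>

text \<open>
  The set \<open>?Q\<close> below consists of the pairs \<open>(y, z)\<close> for which \<open>z\<close> lies in the region dominated by
  \<open>B \<union> {y}\<close>. It is closed, and the value of \<open>HV\<close> at \<open>y\<close> is the measure of its section at \<open>y\<close>.
\<close>

lemma borel_measurable_HV_insert:
  fixes B :: "(real^'n) set"
  assumes "finite B"
  shows "(\<lambda>y. HV s (B \<union> {y})) \<in> borel_measurable borel"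
proof -
  let ?U = "\<Union>b\<in>B. cbox b s"
  let ?Q = "{p :: (real^'n) \<times> (real^'n). snd p \<in> ?U \<or> snd p \<in> cbox (fst p) s}"
  have U: "closed ?U"
    using assms by (intro closed_UN) auto
  have "closed {p :: (real^'n) \<times> (real^'n). \<forall>i. fst p $ i \<le> snd p $ i \<and> snd p $ i \<le> s $ i}"
    by (intro closed_Collect_all closed_Collect_conj closed_Collect_le continuous_intros)
  moreover have "closed {p :: (real^'n) \<times> (real^'n). snd p \<in> ?U}"
    using closed_vimage[OF U continuous_on_snd[OF continuous_on_id]] by (simp add: vimage_def)
  ultimately have "closed ?Q"
    by (simp add: mem_box_cart closed_Collect_disj)
  then have "?Q \<in> sets (borel \<Otimes>\<^sub>M borel)"
    unfolding borel_prod by (rule borel_closed)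
  also have "sets (borel \<Otimes>\<^sub>M borel) = sets (borel \<Otimes>\<^sub>M lborel)"
    by (intro sets_pair_measure_cong) simp_all
  finally have "?Q \<in> sets (borel \<Otimes>\<^sub>M lborel)" .
  then have "(\<lambda>y. emeasure lborel (Pair y -` ?Q)) \<in> borel_measurable borel"
    by (rule lborel.measurable_emeasure_Pair)
  moreover have "emeasure lborel (Pair y -` ?Q) = HV s (B \<union> {y})" for y
  proof -
    have "Pair y -` ?Q = (\<Union>b\<in>B \<union> {y}. cbox b s)" by auto
    moreover have "closed (\<Union>b\<in>B \<union> {y}. cbox b s)"
      using assms by (intro closed_UN) auto
    ultimately show ?thesis
      unfolding HV_def by (simp add: borel_closed)
  qed
  ultimately show ?thesis by simp
qed

theorem proposition4p3:
  fixes C L :: "real ^ 'm ^ 'm"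
  assumes "invertible C" and "L = matrix_inv C"
  shows "(\<forall>A r. finite A \<longrightarrow>
            CHV C r A = ennreal \<bar>det C\<bar> * HV (L *v r) ((\<lambda>a. L *v a) ` A))
       \<and> (\<forall>A r (M :: 'w measure) Y. finite A \<longrightarrow> prob_space M \<longrightarrow> Y \<in> borel_measurable M \<longrightarrow>
            (\<integral>\<^sup>+ \<omega>. (CHV C r (A \<union> {Y \<omega>}) - CHV C r A) \<partial>M)
            = ennreal \<bar>det C\<bar> *
              (\<integral>\<^sup>+ \<omega>. (HV (L *v r) ((\<lambda>a. L *v a) ` A \<union> {L *v Y \<omega>})
                      - HV (L *v r) ((\<lambda>a. L *v a) ` A)) \<partial>M))"
proof (intro conjI allI impI)
  have CHV: "CHV C r A = ennreal \<bar>det C\<bar> * HV (L *v r) ((\<lambda>a. L *v a) ` A)" if "finite A" for A r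
    using CHV_eq_det_mult_HV[OF assms(1) that] assms(2) by simp
  show "CHV C r A = ennreal \<bar>det C\<bar> * HV (L *v r) ((\<lambda>a. L *v a) ` A)" if "finite A" for A r
    using that by (rule CHV)
  fix A :: "(real^'m) set" and r :: "real^'m" and M :: "'w measure" and Y :: "'w \<Rightarrow> real^'m"
  assume A: "finite A" and Y: "Y \<in> borel_measurable M"
  let ?B = "(\<lambda>a. L *v a) ` A"
  let ?I = "\<lambda>\<omega>. HV (L *v r) (?B \<union> {L *v Y \<omega>}) - HV (L *v r) ?B"
  have "CHV C r (A \<union> {Y \<omega>}) - CHV C r A = ennreal \<bar>det C\<bar> * ?I \<omega>" for \<omega>
    using A HV_finite[of ?B "L *v r"] by (simp add: CHV ennreal_right_diff_distrib)
  moreover have "?I \<in> borel_measurable M"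
  proof -
    have "(\<lambda>\<omega>. L *v Y \<omega>) \<in> borel_measurable M"
      by (rule borel_measurable_continuous_on[OF _ Y])
         (intro linear_continuous_on matrix_vector_mul_bounded_linear)
    from measurable_compose[OF this borel_measurable_HV_insert] A
    have "(\<lambda>\<omega>. HV (L *v r) (?B \<union> {L *v Y \<omega>})) \<in> borel_measurable M" by blast
    then show ?thesis by measurable
  qed
  ultimately show "(\<integral>\<^sup>+ \<omega>. (CHV C r (A \<union> {Y \<omega>}) - CHV C r A) \<partial>M)
      = ennreal \<bar>det C\<bar> * (\<integral>\<^sup>+ \<omega>. ?I \<omega> \<partial>M)"
    by (simp add: nn_integral_cmult)
qed

end
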